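(* Let $(E_1,F_1)$ and $(E_2,F_2)$ be two pairs of dual spaces over the same field $K$. Equip $E_1$ with the $\sigma(E_1,F_1)$-topology and $E_2$ with the $\sigma(E_2,F_2)$-topology. Then, for every semi-linear bijection $s:E_1\to E_2$, the following statements are equivalent: (1) The bijection $s$ is bicontinuous (i.e. both $s$ and $s^{-1}$ are continuous). (2) $H\mapsto s(H)$ is a bijection from the set of all $F_1$-closed hyperplanes of $E_1$ onto the set of all $F_2$-closed hyperplanes of $E_2$. (3) $M\mapsto s(M)$ is an isomorphism from the lattice $L_{F_1}(E_1)$ onto the lattice $L_{F_2}(E_2)$.
   Context: Fields are not assumed commutative (i.e. they are division rings). A pair of dual spaces $(E,F)$ over a field $K$ consists of a left vector space $E$ over $K$ and a right vector space $F$ over $K$ together with a nondegenerate bilinear form $\mathcal{B}:E\times F\to K$. For a subspace $A$ of $E$ put $A^\perp=\{y\in F\mid \mathcal{B}(x,y)=0 \text{ for every } x\in A\}$, and for a subspace $B$ of $F$ put $B^\perp=\{x\in E\mid \mathcal{B}(x,y)=0\text{ for every } y\in B\}$. A subspace $A$ of $E$ is called $F$-closed if $A=A^{\perp\perp}$. The set of all $F$-closed subspaces of $E$, ordered by inclusion, is a complete lattice denoted $L_F(E)$. The linear weak topology $\sigma(E,F)$ on $E$ is the translation-invariant topology for which the subspaces $G^\perp$, with $G$ a finite-dimensional subspace of $F$, form a basis of neighbourhoods of $0$ ($K$ carries the discrete topology). A map $s:E_1\to E_2$ is semi-linear if it is additive and there is a field automorphism $\sigma$ of $K$ with $s(\lambda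 x)=\sigma(\lambda)s(x)$ for all $\lambda\in K$, $x\in E_1$. *)

theory Defs
  imports "HOL-Analysis.Abstract_Topology" "HOL-Algebra.Complete_Lattice"
begin

section \<open>Left and right vector spaces over a division ring\<close>

text \<open>
  The scalars are elements of a type of class \<^class>\<open>division_ring\<close>, so multiplication need not be
  commutative; the library locales \<^locale>\<open>module\<close> and \<^locale>\<open>vector_space\<close> require it to be.
\<close>

locale left_vector_space =
  fixes scale :: "'k::division_ring \<Rightarrow> 'e::ab_group_add \<Rightarrow> 'e" (infixr \<open>*l\<close> 75)
  assumes scale_add_right: "a *l (x + y) = a *l x + a *l y"
    and scale_add_left: "(a + b) *l x = a *l x + b *l x"
    and scale_scale: "a *l (b *l x) = (a * b) *l x"
    and scale_one: "1 *l x = x"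

locale right_vector_space =
  fixes scale :: "'f::ab_group_add \<Rightarrow> 'k::division_ring \<Rightarrow> 'f" (infixl \<open>*r\<close> 75)
  assumes scale_add_left: "(x + y) *r a = x *r a + y *r a"
    and scale_add_right: "x *r (a + b) = x *r a + x *r b"
    and scale_scale: "(x *r a) *r b = x *r (a * b)"
    and scale_one: "x *r 1 = x"

definition left_subspace :: "('k::division_ring \<Rightarrow> 'e::ab_group_add \<Rightarrow> 'e) \<Rightarrow> 'e set \<Rightarrow> bool" where
  "left_subspace l A \<longleftrightarrow>
     0 \<in> A \<and> (\<forall>x\<in>A. \<forall>y\<in>A. x + y \<in> A) \<and> (\<forall>c. \<forall>x\<in>A. l c x \<in> A)"

definition right_subspace :: "('f::ab_group_add \<Rightarrow> 'k::division_ring \<Rightarrow> 'f) \<Rightarrow> 'f set \<Rightarrow> bool" where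
  "right_subspace r G \<longleftrightarrow>
     0 \<in> G \<and> (\<forall>x\<in>G. \<forall>y\<in>G. x + y \<in> G) \<and> (\<forall>c. \<forall>x\<in>G. r x c \<in> G)"

text \<open>The term \<open>right_subspace r hull S\<close> is the linear span of \<open>S\<close>.\<close>

definition fin_dim_right_subspace ::
    "('f::ab_group_add \<Rightarrow> 'k::division_ring \<Rightarrow> 'f) \<Rightarrow> 'f set \<Rightarrow> bool" where
  "fin_dim_right_subspace r G \<longleftrightarrow>
     right_subspace r G \<and> (\<exists>S. finite S \<and> G = right_subspace r hull S)"

definition hyperplane :: "('k::division_ring \<Rightarrow> 'e::ab_group_add \<Rightarrow> 'e) \<Rightarrow> 'e set \<Rightarrow> bool" where
  "hyperplane l H \<longleftrightarrow>
     left_subspace l H \<and> H \<noteq> UNIV \<and>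
     (\<forall>A. left_subspace l A \<longrightarrow> H \<subseteq> A \<longrightarrow> A = H \<or> A = UNIV)"

lemma (in left_vector_space) scale_zero_right: "a *l 0 = 0"
  using scale_add_right[of a 0 0] by simp

lemma (in left_vector_space) scale_zero_left: "0 *l x = 0"
  using scale_add_left[of 0 0 x] by simp

lemma (in left_vector_space) scale_minus_left: "(- a) *l x = - (a *l x)"
  using scale_add_left[of "- a" a x] by (simp add: scale_zero_left eq_neg_iff_add_eq_0)

text \<open>Maximal proper subspaces are exactly the subspaces of codimension one.\<close>

lemma (in left_vector_space) hyperplane_iff_codim_one:
  "hyperplane (*l) H \<longleftrightarrow>
     left_subspace (*l) H \<and> (\<exists>x. x \<notin> H \<and> (\<forall>v. \<exists>c. v - c *l x \<in> H))"
proof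
  assume H: "hyperplane (*l) H"
  then have sub: "left_subspace (*l) H" by (simp add: hyperplane_def)
  from H obtain x where x: "x \<notin> H" by (auto simp: hyperplane_def)
  define A where "A = {v. \<exists>c. v - c *l x \<in> H}"
  have "left_subspace (*l) A"
    unfolding left_subspace_def
  proof (intro conjI ballI allI)
    have "0 - 0 *l x \<in> H" using sub by (simp add: scale_zero_left left_subspace_def)
    then show "0 \<in> A" unfolding A_def by blast
  next
    fix u v assume "u \<in> A" "v \<in> A"
    then obtain c d where "u - c *l x \<in> H" "v - d *l x \<in> H" unfolding A_def by blast
    then have "(u - c *l x) + (v - d *l x) \<in> H" using sub by (simp add: left_subspace_def)
    moreover have "(u - c *l x) + (v - d *l x) = (u + v) - (c + d) *l x"
      by (simp add: scale_add_left algebra_simps)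
    ultimately have "(u + v) - (c + d) *l x \<in> H" by (simp only:)
    then show "u + v \<in> A" unfolding A_def by blast
  next
    fix a u assume "u \<in> A"
    then obtain c where "u - c *l x \<in> H" unfolding A_def by blast
    then have "a *l (u - c *l x) \<in> H" using sub by (simp add: left_subspace_def)
    moreover have "a *l (u - c *l x) = a *l u - (a * c) *l x"
      using scale_add_right[of a "u - c *l x" "c *l x"]
      by (simp add: scale_scale algebra_simps)
    ultimately have "a *l u - (a * c) *l x \<in> H" by (simp only:)
    then show "a *l u \<in> A" unfolding A_def by blast
  qed
  moreover have "H \<subseteq> A"
  proof
    fix h assume "h \<in> H"
    then have "h - 0 *l x \<in> H" by (simp add: scale_zero_left)
    then show "h \<in> A" unfolding A_def by blast
  qed
  moreover have "x \<in> A"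
  proof -
    have "x - 1 *l x \<in> H" using sub by (simp add: scale_one left_subspace_def)
    then show ?thesis unfolding A_def by blast
  qed
  ultimately have "A = UNIV" using H x unfolding hyperplane_def by blast
  then show "left_subspace (*l) H \<and> (\<exists>x. x \<notin> H \<and> (\<forall>v. \<exists>c. v - c *l x \<in> H))"
    using sub x unfolding A_def by blast
next
  assume R: "left_subspace (*l) H \<and> (\<exists>x. x \<notin> H \<and> (\<forall>v. \<exists>c. v - c *l x \<in> H))"
  then obtain x where sub: "left_subspace (*l) H" and x: "x \<notin> H"
    and cod: "\<And>v. \<exists>c. v - c *l x \<in> H" by blast
  have "A = UNIV" if A: "left_subspace (*l) A" "H \<subseteq> A" "A \<noteq> H" for A
  proof -
    from A obtain a where a: "a \<in> A" "a \<notin> H" by blast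
    obtain c where c: "a - c *l x \<in> H" using cod by blast
    have neg: "- u \<in> A" if "u \<in> A" for u
    proof -
      have "(- 1) *l u \<in> A" using A(1) that unfolding left_subspace_def by blast
      then show ?thesis by (simp add: scale_minus_left scale_one)
    qed
    have "c \<noteq> 0"
    proof
      assume "c = 0"
      with c have "a \<in> H" by (simp add: scale_zero_left)
      with a(2) show False ..
    qed
    have "- (a - c *l x) \<in> A" using c A(2) by (intro neg) blast
    then have "a + - (a - c *l x) \<in> A" using A(1) a(1) unfolding left_subspace_def by blast
    then have "c *l x \<in> A" by simp
    then have "inverse c *l (c *l x) \<in> A" using A(1) unfolding left_subspace_def by blast
    then have xA: "x \<in> A" using \<open>c \<noteq> 0\<close> by (simp add: scale_scale scale_one)
    have "v \<in> A" for v
    proof -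
      obtain d where "v - d *l x \<in> H" using cod by blast
      then have "(v - d *l x) + d *l x \<in> A"
        using A xA unfolding left_subspace_def by blast
      then show ?thesis by simp
    qed
    then show ?thesis by blast
  qed
  then show "hyperplane (*l) H" using sub x unfolding hyperplane_def by blast
qed


section \<open>Semi-linear maps\<close>

definition field_automorphism :: "('k::division_ring \<Rightarrow> 'k) \<Rightarrow> bool" where
  "field_automorphism \<sigma> \<longleftrightarrow>
     bij \<sigma> \<and> (\<forall>a b. \<sigma> (a + b) = \<sigma> a + \<sigma> b) \<and> (\<forall>a b. \<sigma> (a * b) = \<sigma> a * \<sigma> b) \<and> \<sigma> 1 = 1"

definition semilinear ::
    "('k::division_ring \<Rightarrow> 'e1::ab_group_add \<Rightarrow> 'e1) \<Rightarrow> ('k \<Rightarrow> 'e2::ab_group_add \<Rightarrow> 'e2) \<Rightarrow>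
     ('e1 \<Rightarrow> 'e2) \<Rightarrow> bool" where
  "semilinear l1 l2 s \<longleftrightarrow>
     additive s \<and> (\<exists>\<sigma>. field_automorphism \<sigma> \<and> (\<forall>c x. s (l1 c x) = l2 (\<sigma> c) (s x)))"


section \<open>Pairs of dual spaces\<close>

locale dual_pair = E: left_vector_space l + F: right_vector_space r
  for l :: "'k::division_ring \<Rightarrow> 'e::ab_group_add \<Rightarrow> 'e"
    and r :: "'f::ab_group_add \<Rightarrow> 'k \<Rightarrow> 'f" +
  fixes B :: "'e \<Rightarrow> 'f \<Rightarrow> 'k"
  assumes form_add_left: "B (x + x') y = B x y + B x' y"
    and form_add_right: "B x (y + y') = B x y + B x y'"
    and form_scale_left: "B (l c x) y = c * B x y"
    and form_scale_right: "B x (r y c) = B x y * c"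
    and nondegenerate_left: "(\<And>y. B x y = 0) \<Longrightarrow> x = 0"
    and nondegenerate_right: "(\<And>x. B x y = 0) \<Longrightarrow> y = 0"

definition perp_E :: "('e \<Rightarrow> 'f \<Rightarrow> 'k::zero) \<Rightarrow> 'e set \<Rightarrow> 'f set" where
  "perp_E B A = {y. \<forall>x\<in>A. B x y = 0}"

definition perp_F :: "('e \<Rightarrow> 'f \<Rightarrow> 'k::zero) \<Rightarrow> 'f set \<Rightarrow> 'e set" where
  "perp_F B G = {x. \<forall>y\<in>G. B x y = 0}"

definition F_closed ::
    "('k::division_ring \<Rightarrow> 'e::ab_group_add \<Rightarrow> 'e) \<Rightarrow> ('e \<Rightarrow> 'f \<Rightarrow> 'k) \<Rightarrow> 'e set \<Rightarrow> bool" where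
  "F_closed l B A \<longleftrightarrow> left_subspace l A \<and> A = perp_F B (perp_E B A)"


subsection \<open>The lattice of closed subspaces\<close>

definition closed_lattice ::
    "('k::division_ring \<Rightarrow> 'e::ab_group_add \<Rightarrow> 'e) \<Rightarrow> ('e \<Rightarrow> 'f \<Rightarrow> 'k) \<Rightarrow> 'e set gorder" where
  "closed_lattice l B = \<lparr>carrier = {A. F_closed l B A}, eq = (=), le = (\<subseteq>)\<rparr>"

definition lattice_isomorphism ::
    "('a, 'c) gorder_scheme \<Rightarrow> ('b, 'd) gorder_scheme \<Rightarrow> ('a \<Rightarrow> 'b) \<Rightarrow> bool" where
  "lattice_isomorphism X Y f \<longleftrightarrow>
     bij_betw f (carrier X) (carrier Y) \<and> join_pres X Y f \<and> meet_pres X Y f"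

lemma perp_E_antimono: "A \<subseteq> A' \<Longrightarrow> perp_E B A' \<subseteq> perp_E B A"
  by (auto simp: perp_E_def)

lemma perp_F_antimono: "G \<subseteq> G' \<Longrightarrow> perp_F B G' \<subseteq> perp_F B G"
  by (auto simp: perp_F_def)

lemma subset_perp_F_perp_E: "A \<subseteq> perp_F B (perp_E B A)"
  by (auto simp: perp_F_def perp_E_def)

lemma (in dual_pair) form_zero_left: "B 0 y = 0"
  using form_add_left[of 0 0 y] by simp

lemma (in dual_pair) left_subspace_perp_F: "left_subspace l (perp_F B G)"
  by (auto simp: left_subspace_def perp_F_def form_zero_left form_add_left form_scale_left)

lemma (in dual_pair) F_closed_perp_F: "F_closed l B (perp_F B G)"
  using left_subspace_perp_F by (auto simp: F_closed_def perp_F_def perp_E_def)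

lemma (in dual_pair) F_closed_Inter:
  assumes "\<And>A. A \<in> \<A> \<Longrightarrow> F_closed l B A"
  shows "F_closed l B (\<Inter>\<A>)"
proof -
  have "perp_F B (perp_E B A) = A" if "A \<in> \<A>" for A
    using assms[OF that] unfolding F_closed_def by blast
  then have "\<Inter>\<A> = (\<Inter>A\<in>\<A>. perp_F B (perp_E B A))" by simp
  also have "\<dots> = perp_F B (\<Union>A\<in>\<A>. perp_E B A)" by (auto simp: perp_F_def)
  finally show ?thesis by (simp only: F_closed_perp_F)
qed

lemma (in dual_pair) complete_lattice_closed_lattice:
  "complete_lattice (closed_lattice l B)"
proof -
  interpret partial_order "closed_lattice l B"
    by standard (auto simp: closed_lattice_def)
  show ?thesis
  proof (rule complete_latticeI)
    fix \<A> assume "\<A> \<subseteq> carrier (closed_lattice l B)"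
    then have *: "\<And>A. A \<in> \<A> \<Longrightarrow> F_closed l B A" by (auto simp: closed_lattice_def)
    let ?U = "{C. F_closed l B C \<and> (\<forall>A\<in>\<A>. A \<subseteq> C)}"
    have "F_closed l B (\<Inter>?U)" by (rule F_closed_Inter) blast
    then have "least (closed_lattice l B) (\<Inter>?U) (Upper (closed_lattice l B) \<A>)"
      using * by (auto simp: least_def Upper_def closed_lattice_def)
    then show "\<exists>S. least (closed_lattice l B) S (Upper (closed_lattice l B) \<A>)" ..
    have "F_closed l B (\<Inter>\<A>)" by (rule F_closed_Inter) (fact *)
    then have "greatest (closed_lattice l B) (\<Inter>\<A>) (Lower (closed_lattice l B) \<A>)"
      using * by (auto simp: greatest_def Lower_def closed_lattice_def)
    then show "\<exists>I. greatest (closed_lattice l B) I (Lower (closed_lattice l B) \<A>)" ..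
  qed
qed


subsection \<open>The linear weak topology\<close>

definition weak_topology ::
    "('f::ab_group_add \<Rightarrow> 'k::division_ring \<Rightarrow> 'f) \<Rightarrow> ('e::ab_group_add \<Rightarrow> 'f \<Rightarrow> 'k) \<Rightarrow> 'e topology" where
  "weak_topology r B =
     topology (\<lambda>U. \<forall>x\<in>U. \<exists>G. fin_dim_right_subspace r G \<and> (+) x ` perp_F B G \<subseteq> U)"

lemma right_subspace_hull: "right_subspace r (right_subspace r hull S)"
  by (rule hull_in) (auto simp: right_subspace_def)

lemma fin_dim_right_subspace_hull: "finite S \<Longrightarrow> fin_dim_right_subspace r (right_subspace r hull S)"
  using right_subspace_hull by (auto simp: fin_dim_right_subspace_def)

lemma openin_weak_topology:
  "openin (weak_topology r B) U \<longleftrightarrow>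
     (\<forall>x\<in>U. \<exists>G. fin_dim_right_subspace r G \<and> (+) x ` perp_F B G \<subseteq> U)"
proof -
  let ?P = "\<lambda>U. \<forall>x\<in>U. \<exists>G. fin_dim_right_subspace r G \<and> (+) x ` perp_F B G \<subseteq> U"
  have "istopology ?P"
    unfolding istopology_def
  proof (intro conjI allI impI ballI)
    fix U V x assume U: "?P U" and V: "?P V" and x: "x \<in> U \<inter> V"
    from U x obtain G where G: "fin_dim_right_subspace r G" "(+) x ` perp_F B G \<subseteq> U" by blast
    from V x obtain G' where G': "fin_dim_right_subspace r G'" "(+) x ` perp_F B G' \<subseteq> V" by blast
    from G(1) obtain S where S: "finite S" "G = right_subspace r hull S"
      by (auto simp: fin_dim_right_subspace_def)
    from G'(1) obtain S' where S': "finite S'" "G' = right_subspace r hull S'"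
      by (auto simp: fin_dim_right_subspace_def)
    let ?G = "right_subspace r hull (S \<union> S')"
    have "perp_F B ?G \<subseteq> perp_F B G" "perp_F B ?G \<subseteq> perp_F B G'"
      unfolding S(2) S'(2) by (intro perp_F_antimono hull_mono; blast)+
    then have "(+) x ` perp_F B ?G \<subseteq> U \<inter> V" using G(2) G'(2) by blast
    moreover have "fin_dim_right_subspace r ?G"
      using S(1) S'(1) by (intro fin_dim_right_subspace_hull) simp
    ultimately show "\<exists>G. fin_dim_right_subspace r G \<and> (+) x ` perp_F B G \<subseteq> U \<inter> V" by blast
  next
    fix \<K> x assume K: "\<forall>K\<in>\<K>. ?P K" and "x \<in> \<Union>\<K>"
    then obtain K where "K \<in> \<K>" "x \<in> K" by blast
    with K obtain G where "fin_dim_right_subspace r G" "(+) x ` perp_F B G \<subseteq> K" by blast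
    with \<open>K \<in> \<K>\<close> show "\<exists>G. fin_dim_right_subspace r G \<and> (+) x ` perp_F B G \<subseteq> \<Union>\<K>" by blast
  qed
  then show ?thesis unfolding weak_topology_def by (simp add: topology_inverse')
qed

lemma openin_weak_topology_translation:
  assumes "openin (weak_topology r B) U"
  shows "openin (weak_topology r B) ((+) a ` U)"
  unfolding openin_weak_topology
proof
  fix x assume "x \<in> (+) a ` U"
  then obtain u where u: "u \<in> U" "x = a + u" by blast
  with assms obtain G where "fin_dim_right_subspace r G" "(+) u ` perp_F B G \<subseteq> U"
    unfolding openin_weak_topology by blast
  then show "\<exists>G. fin_dim_right_subspace r G \<and> (+) x ` perp_F B G \<subseteq> (+) a ` U"
    unfolding u(2) by (intro exI[of _ G]) (auto simp: add.assoc)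
qed

lemma (in dual_pair) openin_weak_topology_perp_F:
  assumes "fin_dim_right_subspace r G"
  shows "openin (weak_topology r B) (perp_F B G)"
proof -
  have "(+) x ` perp_F B G \<subseteq> perp_F B G" if "x \<in> perp_F B G" for x
    using left_subspace_perp_F[of G] that by (auto simp: left_subspace_def)
  then show ?thesis using assms unfolding openin_weak_topology by blast
qed

lemma (in dual_pair) weak_topology_basis_at_0:
  "(\<exists>V. openin (weak_topology r B) V \<and> 0 \<in> V \<and> V \<subseteq> N) \<longleftrightarrow>
     (\<exists>G. fin_dim_right_subspace r G \<and> perp_F B G \<subseteq> N)"
proof
  assume "\<exists>V. openin (weak_topology r B) V \<and> 0 \<in> V \<and> V \<subseteq> N"
  then obtain V G where "V \<subseteq> N" "fin_dim_right_subspace r G" "(+) 0 ` perp_F B G \<subseteq> V"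
    unfolding openin_weak_topology by blast
  then show "\<exists>G. fin_dim_right_subspace r G \<and> perp_F B G \<subseteq> N" by auto
next
  assume "\<exists>G. fin_dim_right_subspace r G \<and> perp_F B G \<subseteq> N"
  then obtain G where "fin_dim_right_subspace r G" "perp_F B G \<subseteq> N" by blast
  moreover have "0 \<in> perp_F B G" by (simp add: perp_F_def form_zero_left)
  ultimately show "\<exists>V. openin (weak_topology r B) V \<and> 0 \<in> V \<and> V \<subseteq> N"
    using openin_weak_topology_perp_F by blast
qed

lemma topspace_weak_topology: "topspace (weak_topology r B) = UNIV"
proof -
  have "fin_dim_right_subspace r (right_subspace r hull {})"
    by (rule fin_dim_right_subspace_hull) simp
  then have "openin (weak_topology r B) UNIV" unfolding openin_weak_topology by blast
  then show ?thesis using openin_subset by blast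
qed

end

theory Submission
  imports Defs
begin

text \<open>
  The weak topology, the closed hyperplanes and the lattice of closed subspaces all encode the same
  datum, namely which linear functionals on \<open>E\<close> are represented by elements of \<open>F\<close>. An
  \<open>F\<close>-closed subspace \<open>G\<^sup>\<bottom>\<close> is the intersection of the sets \<open>{y}\<^sup>\<bottom>\<close> with \<open>y \<in> G\<close>, each of which is
  the whole space or a closed hyperplane. On the topological side, a hyperplane is \<open>F\<close>-closed iff it
  is open (\<open>F_closed_hyperplane_iff_open\<close>). The substantial direction is that an open hyperplane
  contains some \<open>G\<^sup>\<bottom>\<close> with \<open>G\<close> finite-dimensional, and a functional vanishing on the common kernel of
  finitely many functionals is a linear combination of them (\<open>functional_representable\<close>).

  From this, for a surjective semi-linear map \<open>s\<close>, which pulls hyperplanes back to hyperplanes, it is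
  equivalent that \<open>s\<close> is continuous, that preimages of closed hyperplanes are closed, and that
  preimages of closed subspaces are closed (\<open>pulls_back_hyperplanes_iff_continuous\<close>,
  \<open>pulls_back_hyperplanes_iff_closed\<close>). If \<open>s\<close> is bijective, then its inverse is semi-linear as well,
  with the inverse automorphism, and the theorem results from applying these equivalences to both
  \<open>s\<close> and its inverse. A lattice isomorphism adds nothing to a bijection of the closed subspaces here,
  since taking images under a bijection preserves and reflects inclusion.
\<close>

section \<open>Closed hyperplanes and the weak topology\<close>

context dual_pair
begin

lemma form_zero_right: "B x 0 = 0"
  using form_add_right[of x 0 0] by simp

lemma form_diff_left: "B (x - x') y = B x y - B x' y"
  using form_add_left[of "x - x'" x' y] by simp

lemma left_subspace_diff:
  assumes "left_subspace l A" "x \<in> A" "y \<in> A"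
  shows "x - y \<in> A"
proof -
  have "x + l (- 1) y \<in> A" using assms unfolding left_subspace_def by blast
  then show ?thesis by (simp add: E.scale_minus_left E.scale_one)
qed

lemma F_closed_UNIV: "F_closed l B UNIV"
  using F_closed_perp_F[of "{}"] by (simp add: perp_F_def)

lemma perp_F_hull: "perp_F B (right_subspace r hull S) = perp_F B S"
proof
  show "perp_F B (right_subspace r hull S) \<subseteq> perp_F B S"
    by (intro perp_F_antimono hull_subset)
  show "perp_F B S \<subseteq> perp_F B (right_subspace r hull S)"
  proof
    fix x assume "x \<in> perp_F B S"
    then have "S \<subseteq> {y. B x y = 0}" by (auto simp: perp_F_def)
    moreover have "right_subspace r {y. B x y = 0}"
      by (simp add: right_subspace_def form_zero_right form_add_right form_scale_right)
    ultimately have "right_subspace r hull S \<subseteq> {y. B x y = 0}" by (rule hull_minimal)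
    then show "x \<in> perp_F B (right_subspace r hull S)" by (auto simp: perp_F_def)
  qed
qed

lemma openin_perp_F_finite:
  "finite S \<Longrightarrow> openin (weak_topology r B) (perp_F B S)"
  using openin_weak_topology_perp_F[OF fin_dim_right_subspace_hull, of S]
  by (simp add: perp_F_hull)

lemma hyperplane_perp_F_singleton:
  assumes "y \<noteq> 0"
  shows "hyperplane l (perp_F B {y})"
proof -
  obtain x where x: "B x y \<noteq> 0" using assms nondegenerate_right by blast
  have "v - l (B v y * inverse (B x y)) x \<in> perp_F B {y}" for v
    using x by (simp add: perp_F_def form_diff_left form_scale_left mult.assoc)
  moreover have "x \<notin> perp_F B {y}" using x by (simp add: perp_F_def)
  ultimately show ?thesis
    unfolding E.hyperplane_iff_codim_one using left_subspace_perp_F by blast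
qed

text \<open>
  A closed proper subspace is annihilated by some nonzero \<open>y\<close>, and a hyperplane, being maximal,
  must then be the whole kernel of \<open>y\<close>.
\<close>

lemma F_closed_hyperplaneE:
  assumes "hyperplane l H" "F_closed l B H"
  obtains y where "y \<noteq> 0" "H = perp_F B {y}"
proof -
  have H: "H = perp_F B (perp_E B H)" "H \<noteq> UNIV"
    using assms by (auto simp: F_closed_def hyperplane_def)
  have "\<exists>y\<in>perp_E B H. y \<noteq> 0"
  proof (rule ccontr)
    assume "\<not> (\<exists>y\<in>perp_E B H. y \<noteq> 0)"
    then have "perp_F B (perp_E B H) = UNIV" by (auto simp: perp_F_def form_zero_right)
    with H show False by simp
  qed
  then obtain y where y: "y \<in> perp_E B H" "y \<noteq> 0" by blast
  then have "H \<subseteq> perp_F B {y}" by (auto simp: perp_F_def perp_E_def)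
  moreover have "perp_F B {y} \<noteq> UNIV"
    using hyperplane_perp_F_singleton[OF y(2)] by (simp add: hyperplane_def)
  ultimately have "H = perp_F B {y}"
    using assms(1) left_subspace_perp_F unfolding hyperplane_def by blast
  with y(2) show ?thesis by (rule that)
qed

text \<open>
  Induction on the number of functionals: after subtracting a suitable multiple of \<open>B \<cdot> y\<close>, the
  functional vanishes on the common kernel of the others. The multiple is determined by one vector
  \<open>u\<close> of that kernel on which \<open>B \<cdot> y\<close> does not vanish.
\<close>

lemma functional_representable:
  assumes "finite S"
    and "\<And>x x'. \<phi> (x + x') = \<phi> x + \<phi> x'"
    and "\<And>c x. \<phi> (l c x) = c * \<phi> x"
    and "\<And>x. x \<in> perp_F B S \<Longrightarrow> \<phi> x = 0"
  shows "\<exists>y. \<forall>x. \<phi> x = B x y"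
  using assms
proof (induction S arbitrary: \<phi> rule: finite_induct)
  case empty
  then have "\<forall>x. \<phi> x = B x 0" by (simp add: perp_F_def form_zero_right)
  then show ?case ..
next
  case (insert y S)
  show ?case
  proof (cases "perp_F B S \<subseteq> perp_F B {y}")
    case True
    then have "perp_F B (insert y S) = perp_F B S" by (auto simp: perp_F_def)
    with insert.prems show ?thesis by (intro insert.IH) auto
  next
    case False
    then obtain u where u: "u \<in> perp_F B S" "B u y \<noteq> 0" by (auto simp: perp_F_def)
    define d where "d = r y (inverse (B u y) * \<phi> u)"
    have "\<exists>z. \<forall>x. \<phi> x - B x d = B x z"
    proof (rule insert.IH)
      fix x assume x: "x \<in> perp_F B S"
      (* Projecting x along u into the kernel of y keeps it in the kernel of S. *)
      let ?c = "B x y * inverse (B u y)"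
      have "x - l ?c u \<in> perp_F B (insert y S)"
        using x u by (simp add: perp_F_def form_diff_left form_scale_left mult.assoc)
      then have "\<phi> (x - l ?c u) = 0" by (rule insert.prems)
      then have "\<phi> x = ?c * \<phi> u"
        using insert.prems(1)[of "x - l ?c u" "l ?c u"] by (simp add: insert.prems(2))
      then show "\<phi> x - B x d = 0" by (simp add: d_def form_scale_right mult.assoc)
    qed (simp_all add: insert.prems(1,2) form_add_left form_scale_left right_diff_distrib)
    then obtain z where z: "\<And>x. \<phi> x - B x d = B x z" by blast
    have "\<phi> x = B x (z + d)" for x using z[of x] by (simp add: form_add_right algebra_simps)
    then show ?thesis by blast
  qed
qed

text \<open>
  The functional is the coordinate along a fixed vector \<open>u\<close> outside \<open>H\<close>: modulo \<open>H\<close>, every vector is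
  a unique multiple of \<open>u\<close>.
\<close>

lemma hyperplane_is_kernel:
  assumes "hyperplane l H"
  obtains \<phi> :: "'e \<Rightarrow> 'k" where
    "\<And>x x'. \<phi> (x + x') = \<phi> x + \<phi> x'"
    "\<And>c x. \<phi> (l c x) = c * \<phi> x"
    "\<And>x. x \<in> H \<longleftrightarrow> \<phi> x = 0"
proof -
  obtain u where sub: "left_subspace l H" and u: "u \<notin> H" and cod: "\<And>v. \<exists>c. v - l c u \<in> H"
    using assms unfolding E.hyperplane_iff_codim_one by blast
  define \<phi> where "\<phi> v = (SOME c. v - l c u \<in> H)" for v
  have \<phi>: "v - l (\<phi> v) u \<in> H" for v
    unfolding \<phi>_def using cod by (rule someI_ex)
  have unique: "\<phi> v = c" if "v - l c u \<in> H" for v c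
  proof (rule ccontr)
    assume ne: "\<phi> v \<noteq> c"
    have "(v - l c u) - (v - l (\<phi> v) u) \<in> H"
      using sub that \<phi> by (rule left_subspace_diff)
    moreover have "(v - l c u) - (v - l (\<phi> v) u) = l (\<phi> v - c) u"
      using E.scale_add_left[of "\<phi> v - c" c u] by simp
    ultimately have "l (\<phi> v - c) u \<in> H" by simp
    then have "l (inverse (\<phi> v - c)) (l (\<phi> v - c) u) \<in> H"
      using sub unfolding left_subspace_def by blast
    with u ne show False by (simp add: E.scale_scale E.scale_one)
  qed
  show ?thesis
  proof
    fix x x'
    have "(x - l (\<phi> x) u) + (x' - l (\<phi> x') u) \<in> H"
      using sub \<phi> unfolding left_subspace_def by blast
    then show "\<phi> (x + x') = \<phi> x + \<phi> x'"
      by (intro unique) (simp add: E.scale_add_left algebra_simps)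
  next
    fix c x
    have "l c (x - l (\<phi> x) u) \<in> H" using sub \<phi> unfolding left_subspace_def by blast
    moreover have "l c (x - l (\<phi> x) u) = l c x - l (c * \<phi> x) u"
      using E.scale_add_right[of c "x - l (\<phi> x) u" "l (\<phi> x) u"]
      by (simp add: E.scale_scale algebra_simps)
    ultimately show "\<phi> (l c x) = c * \<phi> x" by (intro unique) simp
  next
    fix x
    show "x \<in> H \<longleftrightarrow> \<phi> x = 0"
      using unique[of x 0] \<phi>[of x] by (auto simp: E.scale_zero_left)
  qed
qed

text \<open>
  An open hyperplane contains the common kernel of finitely many elements of \<open>F\<close>, so the functional
  defining it is represented by an element of \<open>F\<close>.
\<close>

lemma F_closed_hyperplane_iff_open:
  assumes "hyperplane l H"
  shows "F_closed l B H \<longleftrightarrow> openin (weak_topology r B) H"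
proof
  assume "F_closed l B H"
  with assms obtain y where "H = perp_F B {y}" by (rule F_closed_hyperplaneE)
  then show "openin (weak_topology r B) H" by (simp add: openin_perp_F_finite)
next
  assume "openin (weak_topology r B) H"
  moreover have "0 \<in> H" using assms by (simp add: hyperplane_def left_subspace_def)
  ultimately obtain G where "fin_dim_right_subspace r G" "perp_F B G \<subseteq> H"
    using weak_topology_basis_at_0[of H] by blast
  then obtain S where S: "finite S" "perp_F B S \<subseteq> H"
    by (auto simp: fin_dim_right_subspace_def perp_F_hull)
  obtain \<phi> where \<phi>: "\<And>x x'. \<phi> (x + x') = \<phi> x + \<phi> x'" "\<And>c x. \<phi> (l c x) = c * \<phi> x"
    and ker: "\<And>x. x \<in> H \<longleftrightarrow> \<phi> x = 0"
    using hyperplane_is_kernel[OF assms] by blast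
  have "\<exists>y. \<forall>x. \<phi> x = B x y"
    using S ker by (intro functional_representable[OF S(1) \<phi>]) auto
  then obtain y where "\<And>x. \<phi> x = B x y" by blast
  then have "H = perp_F B {y}" using ker by (auto simp: perp_F_def)
  then show "F_closed l B H" by (simp add: F_closed_perp_F)
qed

end


section \<open>Preimages under semi-linear surjections\<close>

locale semilinear_surjection =
  D1: dual_pair l1 r1 B1 + D2: dual_pair l2 r2 B2
  for l1 :: "'k::division_ring \<Rightarrow> 'e1::ab_group_add \<Rightarrow> 'e1"
    and r1 :: "'f1::ab_group_add \<Rightarrow> 'k \<Rightarrow> 'f1"
    and B1 :: "'e1 \<Rightarrow> 'f1 \<Rightarrow> 'k"
    and l2 :: "'k \<Rightarrow> 'e2::ab_group_add \<Rightarrow> 'e2"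
    and r2 :: "'f2::ab_group_add \<Rightarrow> 'k \<Rightarrow> 'f2"
    and B2 :: "'e2 \<Rightarrow> 'f2 \<Rightarrow> 'k" +
  fixes s :: "'e1 \<Rightarrow> 'e2"
  assumes semilinear: "semilinear l1 l2 s"
    and surj: "surj s"
begin

lemma additive: "additive s"
  using semilinear by (simp add: semilinear_def)

lemma left_subspace_vimage:
  assumes "left_subspace l2 A"
  shows "left_subspace l1 (s -` A)"
proof -
  obtain \<sigma> where "\<And>c x. s (l1 c x) = l2 (\<sigma> c) (s x)"
    using semilinear unfolding semilinear_def by blast
  then show ?thesis
    using assms by (simp add: left_subspace_def additive.zero[OF additive] additive.add[OF additive])
qed

lemma hyperplane_vimage:
  assumes "hyperplane l2 H"
  shows "hyperplane l1 (s -` H)"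
proof -
  obtain \<sigma> where \<sigma>: "surj \<sigma>" and s: "\<And>c x. s (l1 c x) = l2 (\<sigma> c) (s x)"
    using semilinear unfolding semilinear_def field_automorphism_def bij_def by blast
  obtain w where sub: "left_subspace l2 H" and w: "w \<notin> H" and cod: "\<And>v. \<exists>c. v - l2 c w \<in> H"
    using assms unfolding D2.E.hyperplane_iff_codim_one by blast
  obtain u where u: "w = s u" using surj by (rule surjE)
  have "\<exists>c. v - l1 c u \<in> s -` H" for v
  proof -
    obtain d where d: "s v - l2 d w \<in> H" using cod by blast
    obtain c where "d = \<sigma> c" using \<sigma> by (rule surjE)
    with d have "v - l1 c u \<in> s -` H" by (simp add: additive.diff[OF additive] s u)
    then show ?thesis ..
  qed
  moreover have "u \<notin> s -` H" using w u by simp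
  ultimately show ?thesis
    unfolding D1.E.hyperplane_iff_codim_one using left_subspace_vimage[OF sub] by blast
qed

text \<open>
  Only closedness of the preimage is demanded, because preimages of hyperplanes are hyperplanes.
\<close>

definition pulls_back_hyperplanes :: bool where
  "pulls_back_hyperplanes \<longleftrightarrow>
     (\<forall>H. hyperplane l2 H \<and> F_closed l2 B2 H \<longrightarrow> F_closed l1 B1 (s -` H))"

text \<open>
  A closed subspace is an intersection of closed hyperplanes, and preimages commute with
  intersections.
\<close>

lemma pulls_back_hyperplanes_iff_closed:
  "pulls_back_hyperplanes \<longleftrightarrow> (\<forall>M. F_closed l2 B2 M \<longrightarrow> F_closed l1 B1 (s -` M))"
proof
  assume P: pulls_back_hyperplanes
  show "\<forall>M. F_closed l2 B2 M \<longrightarrow> F_closed l1 B1 (s -` M)"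
  proof (intro allI impI)
    fix M assume "F_closed l2 B2 M"
    then have "M = perp_F B2 (perp_E B2 M)" by (simp add: F_closed_def)
    also have "\<dots> = (\<Inter>y\<in>perp_E B2 M. perp_F B2 {y})" by (auto simp: perp_F_def)
    finally have "s -` M = \<Inter>((\<lambda>y. s -` perp_F B2 {y}) ` perp_E B2 M)" by blast
    moreover have "F_closed l1 B1 (s -` perp_F B2 {y})" for y
    proof (cases "y = 0")
      case True
      then have "s -` perp_F B2 {y} = UNIV" by (simp add: perp_F_def D2.form_zero_right)
      then show ?thesis by (simp add: D1.F_closed_UNIV)
    next
      case False
      then show ?thesis
        using P D2.hyperplane_perp_F_singleton D2.F_closed_perp_F
        unfolding pulls_back_hyperplanes_def by blast
    qed
    ultimately show "F_closed l1 B1 (s -` M)" by (auto intro: D1.F_closed_Inter)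
  qed
qed (simp add: pulls_back_hyperplanes_def)

lemma openin_vimage_perp_F_finite:
  assumes pulls_back_hyperplanes and "finite S"
  shows "openin (weak_topology r1 B1) (s -` perp_F B2 S)"
  using assms(2)
proof (induction S rule: finite_induct)
  case empty
  show ?case using openin_topspace[of "weak_topology r1 B1"]
    by (simp add: perp_F_def topspace_weak_topology)
next
  case (insert y S)
  have "openin (weak_topology r1 B1) (s -` perp_F B2 {y})"
  proof (cases "y = 0")
    case True
    then have "s -` perp_F B2 {y} = UNIV" by (simp add: perp_F_def D2.form_zero_right)
    then show ?thesis
      using openin_topspace[of "weak_topology r1 B1"] by (simp add: topspace_weak_topology)
  next
    case False
    then have H: "hyperplane l2 (perp_F B2 {y})" by (rule D2.hyperplane_perp_F_singleton)
    then have "F_closed l1 B1 (s -` perp_F B2 {y})"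
      using assms(1) D2.F_closed_perp_F unfolding pulls_back_hyperplanes_def by blast
    then show ?thesis
      using D1.F_closed_hyperplane_iff_open[OF hyperplane_vimage[OF H]] by simp
  qed
  moreover have "s -` perp_F B2 (insert y S) = s -` perp_F B2 {y} \<inter> s -` perp_F B2 S"
    by (auto simp: perp_F_def)
  ultimately show ?case using insert.IH by (simp add: openin_Int)
qed

text \<open>
  Among hyperplanes, closed means open, so continuity preserves closedness under preimages.
  Conversely, continuity of an additive map is decided at \<open>0\<close>, where the common kernels of
  finitely many elements of \<open>F\<^sub>2\<close>, that is, finite intersections of closed hyperplanes, form a basis.
\<close>

lemma pulls_back_hyperplanes_iff_continuous:
  "pulls_back_hyperplanes \<longleftrightarrow> continuous_map (weak_topology r1 B1) (weak_topology r2 B2) s"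
proof
  assume P: pulls_back_hyperplanes
  have "openin (weak_topology r1 B1) (s -` U)" if U: "openin (weak_topology r2 B2) U" for U
    unfolding openin_weak_topology
  proof
    fix x assume "x \<in> s -` U"
    then obtain G where G: "fin_dim_right_subspace r2 G" "(+) (s x) ` perp_F B2 G \<subseteq> U"
      using U unfolding openin_weak_topology by blast
    then obtain S where S: "finite S" "perp_F B2 S = perp_F B2 G"
      by (auto simp: fin_dim_right_subspace_def D2.perp_F_hull)
    have "openin (weak_topology r1 B1) (s -` perp_F B2 S)"
      using P S(1) by (rule openin_vimage_perp_F_finite)
    moreover have "0 \<in> s -` perp_F B2 S"
      by (simp add: perp_F_def additive.zero[OF additive] D2.form_zero_left)
    ultimately obtain G' where "fin_dim_right_subspace r1 G'" "perp_F B1 G' \<subseteq> s -` perp_F B2 S"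
      using D1.weak_topology_basis_at_0[of "s -` perp_F B2 S"] by blast
    moreover have "x + v \<in> s -` U" if "v \<in> s -` perp_F B2 S" for v
      using that G(2) by (auto simp: S(2) additive.add[OF additive])
    ultimately show "\<exists>G'. fin_dim_right_subspace r1 G' \<and> (+) x ` perp_F B1 G' \<subseteq> s -` U"
      by blast
  qed
  then show "continuous_map (weak_topology r1 B1) (weak_topology r2 B2) s"
    by (simp add: continuous_map_def topspace_weak_topology vimage_def)
next
  assume cont: "continuous_map (weak_topology r1 B1) (weak_topology r2 B2) s"
  show pulls_back_hyperplanes
    unfolding pulls_back_hyperplanes_def
  proof (intro allI impI)
    fix H assume H: "hyperplane l2 H \<and> F_closed l2 B2 H"
    then have "openin (weak_topology r2 B2) H" using D2.F_closed_hyperplane_iff_open by blast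
    then have "openin (weak_topology r1 B1) (s -` H)"
      using cont by (simp add: continuous_map_def topspace_weak_topology vimage_def)
    then show "F_closed l1 B1 (s -` H)"
      using H hyperplane_vimage D1.F_closed_hyperplane_iff_open by blast
  qed
qed

end


section \<open>Bijections of closed subspaces\<close>

text \<open>The automorphism belonging to the inverse map is the inverse automorphism.\<close>

lemma semilinear_inv:
  assumes "semilinear l1 l2 s" "bij s"
  shows "semilinear l2 l1 (inv s)"
proof -
  obtain \<sigma> where add: "additive s" and \<sigma>: "field_automorphism \<sigma>"
    and s: "\<And>c x. s (l1 c x) = l2 (\<sigma> c) (s x)"
    using assms(1) unfolding semilinear_def by blast
  have bij: "bij \<sigma>" using \<sigma> by (simp add: field_automorphism_def)
  note inv_s = inv_f_f[OF bij_is_inj[OF assms(2)]] surj_f_inv_f[OF bij_is_surj[OF assms(2)]]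
  note inv_\<sigma> = inv_f_f[OF bij_is_inj[OF bij]] surj_f_inv_f[OF bij_is_surj[OF bij]]
  have eqI: "inv s y = x" if "y = s x" for x y using that inv_s by simp
  have eqI': "inv \<sigma> y = x" if "y = \<sigma> x" for x y using that inv_\<sigma> by simp
  have "additive (inv s)"
    by standard (rule eqI, simp add: additive.add[OF add] inv_s)
  moreover have "field_automorphism (inv \<sigma>)"
    unfolding field_automorphism_def
  proof (intro conjI allI)
    show "bij (inv \<sigma>)" using bij by (rule bij_imp_bij_inv)
  qed (rule eqI', use \<sigma> in \<open>simp add: field_automorphism_def inv_\<sigma>\<close>)+
  moreover have "inv s (l2 c x) = l1 (inv \<sigma> c) (inv s x)" for c x
    by (rule eqI) (simp add: s inv_s inv_\<sigma>)
  ultimately show ?thesis unfolding semilinear_def by blast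
qed

text \<open>
  This splits a bijection between two families of subsets into a condition on \<open>s\<close> and one on its
  inverse, so that each direction can be treated as a statement about preimages.
\<close>

lemma bij_betw_image_Collect_iff:
  assumes "bij s"
  shows "bij_betw ((`) s) {A. P A} {A. Q A} \<longleftrightarrow>
    (\<forall>A. P A \<longrightarrow> Q (s ` A)) \<and> (\<forall>A. Q A \<longrightarrow> P (s -` A))"
proof -
  have vimage_image: "s -` s ` A = A" for A
    using bij_is_inj[OF assms] by (rule inj_vimage_image_eq)
  show ?thesis
  proof
    assume bij: "bij_betw ((`) s) {A. P A} {A. Q A}"
    have "P (s -` A)" if "Q A" for A
    proof -
      have "A \<in> (`) s ` {A. P A}" using that by (simp add: bij_betw_imp_surj_on[OF bij])
      then show ?thesis by (auto simp: vimage_image)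
    qed
    moreover have "Q (s ` A)" if "P A" for A
      using bij_betw_apply[OF bij, of A] that by simp
    ultimately show "(\<forall>A. P A \<longrightarrow> Q (s ` A)) \<and> (\<forall>A. Q A \<longrightarrow> P (s -` A))" by simp
  next
    assume "(\<forall>A. P A \<longrightarrow> Q (s ` A)) \<and> (\<forall>A. Q A \<longrightarrow> P (s -` A))"
    then show "bij_betw ((`) s) {A. P A} {A. Q A}"
      by (intro bij_betw_byWitness[where f' = "(-`) s"]) 
        (auto simp: vimage_image bij_is_surj[OF assms])
  qed
qed

text \<open>
  Joins and meets are determined by the order, so an order isomorphism between lattices preserves
  them.
\<close>

lemma lattice_isomorphismI:
  assumes "lattice X" "lattice Y" and bij: "bij_betw f (carrier X) (carrier Y)"
    and le: "\<And>x y. x \<in> carrier X \<Longrightarrow> y \<in> carrier X \<Longrightarrow> x \<sqsubseteq>\<^bsub>X\<^esub> y \<longleftrightarrow> f x \<sqsubseteq>\<^bsub>Y\<^esub> f y"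
  shows "lattice_isomorphism X Y f"
proof -
  interpret X: lattice X by fact
  interpret Y: lattice Y by fact
  have f: "f x \<in> carrier Y" if "x \<in> carrier X" for x
    using bij that by (rule bij_betw_apply)
  have pre: "\<exists>z\<in>carrier X. w = f z" if "w \<in> carrier Y" for w
    using bij_betw_imp_surj_on[OF bij] that by blast
  have "f (x \<squnion>\<^bsub>X\<^esub> y) = f x \<squnion>\<^bsub>Y\<^esub> f y" if x: "x \<in> carrier X" and y: "y \<in> carrier X" for x y
  proof (rule Y.le_antisym)
    obtain z where z: "z \<in> carrier X" "f x \<squnion>\<^bsub>Y\<^esub> f y = f z"
      using pre[OF Y.join_closed] x y f by blast
    then have "x \<sqsubseteq>\<^bsub>X\<^esub> z" "y \<sqsubseteq>\<^bsub>X\<^esub> z"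
      using x y f le Y.join_left[of "f x" "f y"] Y.join_right[of "f x" "f y"] by auto
    then have "x \<squnion>\<^bsub>X\<^esub> y \<sqsubseteq>\<^bsub>X\<^esub> z" using x y z by (intro X.join_le)
    then show "f (x \<squnion>\<^bsub>X\<^esub> y) \<sqsubseteq>\<^bsub>Y\<^esub> f x \<squnion>\<^bsub>Y\<^esub> f y" using x y z le by simp
    show "f x \<squnion>\<^bsub>Y\<^esub> f y \<sqsubseteq>\<^bsub>Y\<^esub> f (x \<squnion>\<^bsub>X\<^esub> y)"
      using x y f le X.join_left X.join_right X.join_closed by (intro Y.join_le) auto
  qed (use x y f in auto)
  moreover
  have "f (x \<sqinter>\<^bsub>X\<^esub> y) = f x \<sqinter>\<^bsub>Y\<^esub> f y" if x: "x \<in> carrier X" and y: "y \<in> carrier X" for x y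
  proof (rule Y.le_antisym)
    obtain z where z: "z \<in> carrier X" "f x \<sqinter>\<^bsub>Y\<^esub> f y = f z"
      using pre[OF Y.meet_closed] x y f by blast
    then have "z \<sqsubseteq>\<^bsub>X\<^esub> x" "z \<sqsubseteq>\<^bsub>X\<^esub> y"
      using x y f le Y.meet_left[of "f x" "f y"] Y.meet_right[of "f x" "f y"] by auto
    then have "z \<sqsubseteq>\<^bsub>X\<^esub> x \<sqinter>\<^bsub>X\<^esub> y" using x y z by (intro X.meet_le)
    then show "f x \<sqinter>\<^bsub>Y\<^esub> f y \<sqsubseteq>\<^bsub>Y\<^esub> f (x \<sqinter>\<^bsub>X\<^esub> y)" using x y z le by simp
    show "f (x \<sqinter>\<^bsub>X\<^esub> y) \<sqsubseteq>\<^bsub>Y\<^esub> f x \<sqinter>\<^bsub>Y\<^esub> f y"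
      using x y f le X.meet_left X.meet_right X.meet_closed by (intro Y.meet_le) auto
  qed (use x y f in auto)
  ultimately show ?thesis
    using assms by (simp add: lattice_isomorphism_def join_pres_def meet_pres_def)
qed

theorem proposition3:
  fixes l1 :: "'k::division_ring \<Rightarrow> 'e1::ab_group_add \<Rightarrow> 'e1"
    and r1 :: "'f1::ab_group_add \<Rightarrow> 'k \<Rightarrow> 'f1"
    and B1 :: "'e1 \<Rightarrow> 'f1 \<Rightarrow> 'k"
    and l2 :: "'k \<Rightarrow> 'e2::ab_group_add \<Rightarrow> 'e2"
    and r2 :: "'f2::ab_group_add \<Rightarrow> 'k \<Rightarrow> 'f2"
    and B2 :: "'e2 \<Rightarrow> 'f2 \<Rightarrow> 'k"
    and s :: "'e1 \<Rightarrow> 'e2"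
  assumes "dual_pair l1 r1 B1"
    and "dual_pair l2 r2 B2"
    and "semilinear l1 l2 s"
    and "bij s"
  shows "(continuous_map (weak_topology r1 B1) (weak_topology r2 B2) s \<and>
          continuous_map (weak_topology r2 B2) (weak_topology r1 B1) (inv s)
          \<longleftrightarrow>
          bij_betw ((`) s)
            {H. hyperplane l1 H \<and> F_closed l1 B1 H} {H. hyperplane l2 H \<and> F_closed l2 B2 H})
       \<and> (bij_betw ((`) s)
            {H. hyperplane l1 H \<and> F_closed l1 B1 H} {H. hyperplane l2 H \<and> F_closed l2 B2 H}
          \<longleftrightarrow>
          lattice_isomorphism (closed_lattice l1 B1) (closed_lattice l2 B2) ((`) s))"
proof -
  interpret D1: dual_pair l1 r1 B1 by fact
  interpret D2: dual_pair l2 r2 B2 by fact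
  have bij: "bij s" by fact
  interpret S: semilinear_surjection l1 r1 B1 l2 r2 B2 s
    by unfold_locales (use assms in \<open>simp_all add: bij_is_surj\<close>)
  interpret T: semilinear_surjection l2 r2 B2 l1 r1 B1 "inv s"
    by unfold_locales (use assms in \<open>simp_all add: semilinear_inv bij_imp_bij_inv bij_is_surj\<close>)
  have vimage_inv: "inv s -` A = s ` A" for A
    by (simp add: bij_vimage_eq_inv_image[OF bij_imp_bij_inv[OF bij]] inv_inv_eq[OF bij])
  let ?hyperplanes = "bij_betw ((`) s)
    {H. hyperplane l1 H \<and> F_closed l1 B1 H} {H. hyperplane l2 H \<and> F_closed l2 B2 H}"
  let ?pulls_back = "S.pulls_back_hyperplanes \<and> T.pulls_back_hyperplanes"

  have hyperplanes: "?hyperplanes \<longleftrightarrow> ?pulls_back"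
    unfolding bij_betw_image_Collect_iff[OF bij]
      S.pulls_back_hyperplanes_def T.pulls_back_hyperplanes_def vimage_inv
    using S.hyperplane_vimage T.hyperplane_vimage[unfolded vimage_inv] by blast

  have lattice: "lattice (closed_lattice l B)" if "dual_pair l r B"
    for l :: "'k \<Rightarrow> 'e::ab_group_add \<Rightarrow> 'e" and r :: "'f::ab_group_add \<Rightarrow> 'k \<Rightarrow> 'f" and B
  proof -
    interpret complete_lattice "closed_lattice l B"
      using that by (rule dual_pair.complete_lattice_closed_lattice)
    show ?thesis ..
  qed
  have "lattice_isomorphism (closed_lattice l1 B1) (closed_lattice l2 B2) ((`) s) \<longleftrightarrow>
      bij_betw ((`) s) {A. F_closed l1 B1 A} {A. F_closed l2 B2 A}"
  proof
    show "bij_betw ((`) s) {A. F_closed l1 B1 A} {A. F_closed l2 B2 A}"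
      if "lattice_isomorphism (closed_lattice l1 B1) (closed_lattice l2 B2) ((`) s)"
      using that by (simp add: lattice_isomorphism_def closed_lattice_def)
    show "lattice_isomorphism (closed_lattice l1 B1) (closed_lattice l2 B2) ((`) s)"
      if "bij_betw ((`) s) {A. F_closed l1 B1 A} {A. F_closed l2 B2 A}"
      using that lattice[OF assms(1)] lattice[OF assms(2)]
      by (intro lattice_isomorphismI)
        (auto simp: closed_lattice_def inj_image_subset_iff bij_is_inj[OF bij])
  qed
  also have "\<dots> \<longleftrightarrow> ?pulls_back"
    unfolding bij_betw_image_Collect_iff[OF bij]
      S.pulls_back_hyperplanes_iff_closed T.pulls_back_hyperplanes_iff_closed vimage_inv
    by blast
  finally have lattice_iso:
    "lattice_isomorphism (closed_lattice l1 B1) (closed_lattice l2 B2) ((`) s) \<longleftrightarrow> ?pulls_back" .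

  show ?thesis
    unfolding hyperplanes lattice_iso
    by (simp only: S.pulls_back_hyperplanes_iff_continuous T.pulls_back_hyperplanes_iff_continuous
        simp_thms)
qed

end
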